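(* If $\Lambda_X(\mathcal{A})$ is empty, then $C_X(\mathcal{A})=\mathbb{R}^{\mathcal{A}}_+$. Otherwise, \[C_X(\mathcal{A})=\operatorname{cl}\Big(\operatorname{conv}\bigcup_{\lambda\in\Lambda_X^\star(\mathcal{A})}C_X(\mathcal{A},\lambda)\Big).\]
   Context: $X\subset\mathbb{R}^n$ is a nonempty closed convex set and $\mathcal{A}\subset\mathbb{R}^n$ is a nonempty finite set such that the functions $x\mapsto\exp(\alpha^Tx)$, $\alpha\in\mathcal{A}$, are linearly independent on $X$. $\mathbb{R}^{\mathcal{A}}$ denotes real vectors indexed by $\mathcal{A}$. $\mathcal{A}\nu=\sum_\alpha\alpha\nu_\alpha$. $\sigma_X(y)=\sup\{y^Tx:x\in X\}$. $N_\beta=\{\nu\in\mathbb{R}^{\mathcal{A}}:\nu_\alpha\ge0\ \forall\alpha\neq\beta,\ \sum_\alpha\nu_\alpha=0\}$. A vector $\nu^\star\in N_\beta$ is an $X$-circuit of $\mathcal{A}$ if (1) $\nu^\star\neq0$, (2) $\sigma_X(-\mathcal{A}\nu^\star)<\infty$, and (3) $\nu^\star$ cannot be written as a convex combination of two non-proportional vectors $\nu^{(1)},\nu^{(2)}\in N_\beta$ such that the map $\nu\mapsto\sigma_X(-\mathcal{A}\nu)$ is affine on the segment $[\nu^{(1)},\nu^{(2)}]$. $\Lambda_X(\mathcal{A})$ is the set of all $X$-circuits $\lambda$ (over all $\beta\in\mathcal{A}$) normalized so that the unique negative entry equals $-1$. The functional form of $\lambda\in\Lambda_X(\mathcal{A})$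 is $\phi_\lambda=(\lambda,\sigma_X(-\mathcal{A}\lambda))\in\mathbb{R}^{\mathcal{A}}\times\mathbb{R}$. The circuit graph is $G_X(\mathcal{A})=\operatorname{cone}(\{\phi_\lambda:\lambda\in\Lambda_X(\mathcal{A})\}\cup\{(0,1)\})$. The set of normalized reduced $X$-circuits $\Lambda_X^\star(\mathcal{A})$ consists of those $\lambda\in\Lambda_X(\mathcal{A})$ for which $\{t\phi_\lambda:t\ge0\}$ is an extreme ray of $G_X(\mathcal{A})$. Signomials $f=\sum_\alpha c_\alpha\mathrm{e}^\alpha$, $\mathrm{e}^\alpha(x)=\exp(\alpha^Tx)$, are identified with $c\in\mathbb{R}^{\mathcal{A}}$; $C_X(\mathcal{A},\beta)$ is the set of $c$ with $f$ nonnegative on $X$ and $c_\alpha\ge0$ for $\alpha\ne\beta$, and $C_X(\mathcal{A})=\sum_{\beta\in\mathcal{A}}C_X(\mathcal{A},\beta)$. For $\lambda\in\Lambda_X(\mathcal{A})$ with negative index $\beta$ and $\lambda^+=\{\alpha:\lambda_\alpha>0\}$, the $\lambda$-witnessed AGE cone is $C_X(\mathcal{A},\lambda)=\{c: c_\alpha\ge0\ \forall\alpha\neq\beta,\ \prod_{\alpha\in\lambda^+}(c_\alpha/\lambda_\alpha)^{\lambda_\alpha}\ge -c_\beta\exp(\sigma_X(-\mathcal{A}\lambda))\}$. *)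

theory Defs
  imports "HOL-Analysis.Analysis"
begin

text \<open>Exponent set \<A> is encoded by an injective enumeration A :: 'k \<Rightarrow> real^'n with 'k a
finite index type, so that \<A> = range A and \<real>^\<A> is identified with real^'k.\<close>

definition supp_fn :: "(real^'n) set \<Rightarrow> real^'n \<Rightarrow> ereal" where
  "supp_fn X y = Sup ((\<lambda>x. ereal (y \<bullet> x)) ` X)"

definition Amul :: "('k::finite \<Rightarrow> real^'n) \<Rightarrow> real^'k \<Rightarrow> real^'n" where
  "Amul A \<nu> = (\<Sum>k\<in>UNIV. (\<nu> $ k) *\<^sub>R A k)"

definition Nset :: "'k::finite \<Rightarrow> (real^'k) set" where
  "Nset \<beta> = {\<nu>. (\<forall>k. k \<noteq> \<beta> \<longrightarrow> \<nu> $ k \<ge> 0) \<and> (\<Sum>k\<in>UNIV. \<nu> $ k) = 0}"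

definition affine_on_seg :: "(real^'n) set \<Rightarrow> ('k::finite \<Rightarrow> real^'n) \<Rightarrow> real^'k \<Rightarrow> real^'k \<Rightarrow> bool" where
  "affine_on_seg X A \<nu>1 \<nu>2 \<longleftrightarrow>
     (\<exists>a b::real. \<forall>t\<in>{0..1}.
        supp_fn X (- Amul A ((1 - t) *\<^sub>R \<nu>1 + t *\<^sub>R \<nu>2)) = ereal (a + b * t))"

definition X_circuit :: "(real^'n) set \<Rightarrow> ('k::finite \<Rightarrow> real^'n) \<Rightarrow> 'k \<Rightarrow> real^'k \<Rightarrow> bool" where
  "X_circuit X A \<beta> \<nu> \<longleftrightarrow>
     \<nu> \<in> Nset \<beta> \<and> \<nu> \<noteq> 0 \<and> supp_fn X (- Amul A \<nu>) < \<infinity> \<and>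
     \<not> (\<exists>\<nu>1 \<nu>2 \<theta>. \<nu>1 \<in> Nset \<beta> \<and> \<nu>2 \<in> Nset \<beta> \<and>
          \<not> (\<exists>c. \<nu>1 = c *\<^sub>R \<nu>2) \<and> \<not> (\<exists>c. \<nu>2 = c *\<^sub>R \<nu>1) \<and>
          0 < \<theta> \<and> \<theta> < 1 \<and> \<nu> = \<theta> *\<^sub>R \<nu>1 + (1 - \<theta>) *\<^sub>R \<nu>2 \<and>
          affine_on_seg X A \<nu>1 \<nu>2)"

definition Lambda_X :: "(real^'n) set \<Rightarrow> ('k::finite \<Rightarrow> real^'n) \<Rightarrow> (real^'k) set" where
  "Lambda_X X A = {lam. \<exists>\<beta>. X_circuit X A \<beta> lam \<and> lam $ \<beta> = -1}"

definition phi :: "(real^'n) set \<Rightarrow> ('k::finite \<Rightarrow> real^'n) \<Rightarrow> real^'k \<Rightarrow> (real^'k) \<times> real" where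
  "phi X A lam = (lam, real_of_ereal (supp_fn X (- Amul A lam)))"

definition circuit_graph :: "(real^'n) set \<Rightarrow> ('k::finite \<Rightarrow> real^'n) \<Rightarrow> ((real^'k) \<times> real) set" where
  "circuit_graph X A = convex_cone hull (phi X A ` Lambda_X X A \<union> {(0, 1)})"

definition Lambda_X_star :: "(real^'n) set \<Rightarrow> ('k::finite \<Rightarrow> real^'n) \<Rightarrow> (real^'k) set" where
  "Lambda_X_star X A = {lam\<in>Lambda_X X A.
      {t *\<^sub>R phi X A lam | t. t \<ge> 0} face_of circuit_graph X A}"

definition signomial :: "('k::finite \<Rightarrow> real^'n) \<Rightarrow> real^'k \<Rightarrow> real^'n \<Rightarrow> real" where
  "signomial A c x = (\<Sum>k\<in>UNIV. c $ k * exp (A k \<bullet> x))"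

definition C_beta :: "(real^'n) set \<Rightarrow> ('k::finite \<Rightarrow> real^'n) \<Rightarrow> 'k \<Rightarrow> (real^'k) set" where
  "C_beta X A \<beta> = {c. (\<forall>k. k \<noteq> \<beta> \<longrightarrow> c $ k \<ge> 0) \<and> (\<forall>x\<in>X. signomial A c x \<ge> 0)}"

definition SAGE_cone :: "(real^'n) set \<Rightarrow> ('k::finite \<Rightarrow> real^'n) \<Rightarrow> (real^'k) set" where
  "SAGE_cone X A = {c. \<exists>g. (\<forall>\<beta>. g \<beta> \<in> C_beta X A \<beta>) \<and> c = (\<Sum>\<beta>\<in>UNIV. g \<beta>)}"

definition C_lambda :: "(real^'n) set \<Rightarrow> ('k::finite \<Rightarrow> real^'n) \<Rightarrow> real^'k \<Rightarrow> (real^'k) set" where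
  "C_lambda X A lam = {c. \<exists>\<beta>. lam $ \<beta> < 0 \<and> (\<forall>k. k \<noteq> \<beta> \<longrightarrow> c $ k \<ge> 0) \<and>
      (\<Prod>k\<in>{k. lam $ k > 0}. (c $ k / lam $ k) powr (lam $ k))
        \<ge> - c $ \<beta> * exp (real_of_ereal (supp_fn X (- Amul A lam)))}"

definition nonneg_orthant :: "(real^'k::finite) set" where
  "nonneg_orthant = {c. \<forall>k. c $ k \<ge> 0}"

end

theory Submission
  imports Defs
begin

text \<open>
  The circuit graph is the sum over \<open>\<beta>\<close> of the epigraphs of \<open>\<nu> \<mapsto> \<sigma>\<^sub>X(-\<A>\<nu>)\<close> on \<open>N\<^sub>\<beta>\<close>. Linear independence
  gives a positive vector \<open>v\<close> that is strictly positive on nonzero signomials nonnegative on \<open>X\<close>,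
  and by the AM-GM inequality \<open>(ln v, 1)\<close> is then strictly positive on these epigraphs away from 0.
  So they have compact bases, and by Krein-Milman the graph is generated by its extreme rays, which
  are \<open>(0,1)\<close> and the rays of reduced circuits.

  The inclusion of the SAGE cone is proved dually. If \<open>v > 0\<close> is nonnegative on all reduced
  \<open>\<lambda>\<close>-witnessed cones, then \<open>(ln v, 1)\<close> is nonnegative on the extreme rays of the graph, hence on each
  epigraph. By separation, \<open>ln v\<close> is then a limit of vectors \<open>z\<close> such that
  \<open>z\<^sub>\<alpha> - z\<^sub>\<beta> \<ge> (\<alpha> - \<beta>)\<^sup>Tx\<close> for all \<open>\<alpha>\<close> and some \<open>x \<in> X\<close>, and this makes \<open>v\<close> nonnegative on
  \<open>C\<^sub>X(\<A>,\<beta>)\<close>.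
\<close>

section \<open>Cones with a compact base\<close>

text \<open>On the compact set of unit vectors of \<open>E\<close>, \<open>l\<close> has a positive
  lower bound \<open>m\<close>. By homogeneity, points of the base have norm at most
  \<open>1 / m\<close>.\<close>

lemma compact_cone_base:
  fixes E :: "'a::euclidean_space set"
  assumes "closed E" "conic E" and pos: "\<And>y. y \<in> E \<Longrightarrow> y \<noteq> 0 \<Longrightarrow> 0 < l \<bullet> y"
  shows "compact (E \<inter> {y. l \<bullet> y = 1})"
proof -
  have "\<exists>m>0. \<forall>y\<in>E \<inter> sphere 0 1. m \<le> l \<bullet> y"
  proof (cases "E \<inter> sphere 0 1 = {}")
    case True
    then show ?thesis by (auto intro: exI[of _ 1])
  next
    case False
    have "compact (E \<inter> sphere 0 1)"
      using \<open>closed E\<close> by (simp add: closed_Int_compact)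
    moreover have "continuous_on (E \<inter> sphere 0 1) (\<lambda>y. l \<bullet> y)"
      by (intro continuous_intros)
    ultimately obtain z where z: "z \<in> E \<inter> sphere 0 1" "\<forall>y\<in>E \<inter> sphere 0 1. l \<bullet> z \<le> l \<bullet> y"
      using continuous_attains_inf False by blast
    moreover have "0 < l \<bullet> z"
      using z(1) by (intro pos) auto
    ultimately show ?thesis by blast
  qed
  then obtain m where m: "m > 0" "\<And>y. y \<in> E \<inter> sphere 0 1 \<Longrightarrow> m \<le> l \<bullet> y"
    by blast
  have "norm y \<le> 1 / m" if "y \<in> E" "l \<bullet> y = 1" for y
  proof -
    have "y \<noteq> 0" using that by auto
    then have "(1 / norm y) *\<^sub>R y \<in> E \<inter> sphere 0 1"
      using \<open>conic E\<close> that by (auto simp: conic_def)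
    from m(2)[OF this] have "m \<le> 1 / norm y"
      using that by simp
    then show ?thesis
      using m(1) \<open>y \<noteq> 0\<close> by (simp add: field_simps)
  qed
  then have "bounded (E \<inter> {y. l \<bullet> y = 1})"
    unfolding bounded_iff by blast
  moreover have "closed (E \<inter> {y. l \<bullet> y = 1})"
    using \<open>closed E\<close> by (intro closed_Int closed_hyperplane)
  ultimately show ?thesis
    by (simp add: compact_eq_bounded_closed)
qed

lemma inner_convex_hull_base:
  assumes "y \<in> convex hull (E \<inter> {y. l \<bullet> y = 1})"
  shows "l \<bullet> y = 1"
proof -
  have "convex hull (E \<inter> {y. l \<bullet> y = 1}) \<subseteq> {y. l \<bullet> y = 1}"
    by (intro hull_minimal) (auto simp: convex_hyperplane)
  then show ?thesis using assms by blast
qed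

lemma conic_subset_if_base_subset:
  assumes "conic E" and pos: "\<And>y. y \<in> E \<Longrightarrow> y \<noteq> 0 \<Longrightarrow> 0 < l \<bullet> y"
    and "conic K" "0 \<in> K" "E \<inter> {y. l \<bullet> y = 1} \<subseteq> K"
  shows "E \<subseteq> K"
proof
  fix y assume y: "y \<in> E"
  show "y \<in> K"
  proof (cases "y = 0")
    case False
    then have l: "l \<bullet> y > 0" using pos y by blast
    then have "(1 / (l \<bullet> y)) *\<^sub>R y \<in> E \<inter> {y. l \<bullet> y = 1}"
      using \<open>conic E\<close> y by (auto simp: conic_def)
    then have "(l \<bullet> y) *\<^sub>R ((1 / (l \<bullet> y)) *\<^sub>R y) \<in> K"
      using assms(3,5) l unfolding conic_def by (meson less_imp_le subsetD)
    then show ?thesis using l by simp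
  qed (use assms in simp)
qed

text \<open>The Krein-Milman theorem in Minkowski's form applies to the convex hull of the compact
  base. Passing to this hull admits a nonconvex \<open>E\<close>, such as a union of
  epigraphs.\<close>

lemma conic_subset_if_extreme_points:
  fixes E :: "'a::euclidean_space set"
  assumes "closed E" "conic E" and pos: "\<And>y. y \<in> E \<Longrightarrow> y \<noteq> 0 \<Longrightarrow> 0 < l \<bullet> y"
    and K: "convex_cone K"
    and ext: "\<And>p. p extreme_point_of (convex hull (E \<inter> {y. l \<bullet> y = 1})) \<Longrightarrow> p \<in> K"
  shows "E \<subseteq> K"
proof (rule conic_subset_if_base_subset[OF \<open>conic E\<close> pos])
  let ?B = "convex hull (E \<inter> {y. l \<bullet> y = 1})"
  have "?B = convex hull {p. p extreme_point_of ?B}"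
    by (intro Krein_Milman_Minkowski compact_convex_hull compact_cone_base assms) auto
  also have "\<dots> \<subseteq> K"
    using K ext by (intro hull_minimal) (auto simp: convex_cone_def)
  finally show "E \<inter> {y. l \<bullet> y = 1} \<subseteq> K"
    using hull_subset[of _ convex] by (rule order_trans[rotated])
qed (use K in \<open>auto simp: convex_cone_def convex_cone_contains_0\<close>)

text \<open>Since \<open>l\<close> is 1 on the base, it reads off the scale of each point of the
  generated cone. A segment through the ray of \<open>p\<close> rescales to a segment of the base
  through \<open>p\<close>, which extremality collapses.\<close>

lemma extreme_point_base_imp_extreme_ray:
  fixes E :: "'a::euclidean_space set"
  assumes "conic E" and pos: "\<And>y. y \<in> E \<Longrightarrow> y \<noteq> 0 \<Longrightarrow> 0 < l \<bullet> y"
    and p: "p extreme_point_of (convex hull (E \<inter> {y. l \<bullet> y = 1}))"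
  shows "{t *\<^sub>R p | t. t \<ge> 0} face_of (convex_cone hull E)"
proof -
  let ?B = "convex hull (E \<inter> {y. l \<bullet> y = 1})"
  let ?G = "convex_cone hull E"
  have pB: "p \<in> ?B" and lp: "l \<bullet> p = 1"
    using p inner_convex_hull_base[of p E l] by (auto simp: extreme_point_of_def)
  have 0: "0 \<in> conic hull ?B"
    using conicD[OF conic_conic_hull hull_inc[OF pB], of 0] by simp
  have "E \<subseteq> conic hull ?B"
    by (rule conic_subset_if_base_subset[OF \<open>conic E\<close> pos conic_conic_hull 0
          order_trans[OF hull_subset hull_subset]])
  moreover have "convex_cone (conic hull ?B)"
    using 0 convex_conic_hull[OF convex_convex_hull] conic_conic_hull
    unfolding convex_cone_def by blast
  ultimately have "?G \<subseteq> conic hull ?B"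
    by (rule hull_minimal)
  then have G: "\<exists>c b. c \<ge> 0 \<and> b \<in> ?B \<and> y = c *\<^sub>R b" if "y \<in> ?G" for y
    using that unfolding conic_hull_explicit by blast
  have "p \<in> ?G"
    using extreme_point_of_convex_hull[OF p] by (auto intro: hull_inc)
  then have sub: "{t *\<^sub>R p | t. t \<ge> 0} \<subseteq> ?G"
    by (auto intro: convex_cone_hull_mul)
  have cvx: "convex {t *\<^sub>R p | t. t \<ge> 0}"
  proof -
    have "{t *\<^sub>R p | t. t \<ge> 0} = conic hull {p}"
      by (auto simp: conic_hull_explicit)
    then show ?thesis by (simp add: convex_conic_hull)
  qed
  have "a \<in> {t *\<^sub>R p | t. t \<ge> 0} \<and> b \<in> {t *\<^sub>R p | t. t \<ge> 0}"
    if ab: "a \<in> ?G" "b \<in> ?G" and x: "x = t *\<^sub>R p" "t \<ge> 0" and seg: "x \<in> open_segment a b" for a b x t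
  proof -
    obtain r a' where a: "r \<ge> 0" "a' \<in> ?B" "a = r *\<^sub>R a'" using G ab by blast
    obtain s b' where b: "s \<ge> 0" "b' \<in> ?B" "b = s *\<^sub>R b'" using G ab by blast
    obtain u where u: "0 < u" "u < 1" and xu: "x = (1 - u) *\<^sub>R a + u *\<^sub>R b" and "a \<noteq> b"
      using seg by (auto simp: in_segment)
    have la: "l \<bullet> a' = 1" "l \<bullet> b' = 1" using a b inner_convex_hull_base by blast+
    have "l \<bullet> x = t" using x lp by simp
    moreover have "l \<bullet> x = (1 - u) * r + u * s"
      using la a b by (simp add: xu inner_add_right)
    ultimately have t: "t = (1 - u) * r + u * s" by simp
    \<comment> \<open>An endpoint at the origin cannot be rescaled to the base; then the other
      endpoint is a multiple of \<open>p\<close> at once.\<close>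
    consider "r = 0" "s = 0" | "r = 0" "s > 0" | "r > 0" "s = 0" | "r > 0" "s > 0"
      using a(1) b(1) by linarith
    then show ?thesis
    proof cases
      case 1
      then show ?thesis using \<open>a \<noteq> b\<close> a b by simp
    next
      case 2
      then have "u *\<^sub>R b = t *\<^sub>R p" using a x xu by simp
      then have "b = (t / u) *\<^sub>R p"
        using u by (metis divideR_right divide_inverse_commute less_irrefl scaleR_scaleR)
      moreover have "a = 0 *\<^sub>R p" using a 2 by simp
      moreover have "t / u \<ge> 0" using u x by simp
      ultimately show ?thesis by blast
    next
      case 3
      then have "(1 - u) *\<^sub>R a = t *\<^sub>R p" using b x xu by simp
      then have "a = (t / (1 - u)) *\<^sub>R p"
        using u by (metis diff_gt_0_iff_gt divideR_right divide_inverse_commute less_irrefl scaleR_scaleR)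
      moreover have "b = 0 *\<^sub>R p" using b 3 by simp
      moreover have "t / (1 - u) \<ge> 0" using u x by simp
      ultimately show ?thesis by blast
    next
      case 4
      \<comment> \<open>Dividing by \<open>t = (1 - u) * r + u * s\<close> turns the coefficients of
        \<open>a'\<close> and \<open>b'\<close> into weights with sum 1.\<close>
      define w where "w = u * s / t"
      have t0: "t > 0" unfolding t using 4 u by (simp add: add_pos_pos)
      have w: "0 < w" "1 - w = (1 - u) * r / t" "w < 1"
        using t0 4 u by (auto simp: w_def field_simps t)
      have "t *\<^sub>R p = ((1 - u) * r) *\<^sub>R a' + (u * s) *\<^sub>R b'"
        using x xu a b by simp
      then have "(1 / t) *\<^sub>R (t *\<^sub>R p) = (1 / t) *\<^sub>R (((1 - u) * r) *\<^sub>R a' + (u * s) *\<^sub>R b')"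
        by simp
      then have pw: "p = (1 - w) *\<^sub>R a' + w *\<^sub>R b'"
        using t0 unfolding w(2) by (simp add: scaleR_add_right w_def)
      have "a' = b'"
      proof (rule ccontr)
        assume "a' \<noteq> b'"
        then have "p \<in> open_segment a' b'"
          using w pw by (auto simp: in_segment)
        then show False using p a b by (auto simp: extreme_point_of_def)
      qed
      then have "p = a'" using pw by (simp add: scaleR_add_left[symmetric])
      then show ?thesis using a b \<open>a' = b'\<close> by blast
    qed
  qed
  then show ?thesis
    unfolding face_of_def using sub cvx by blast
qed

section \<open>Support function epigraphs\<close>

text \<open>The epigraph of the support function term over \<open>Nset \<beta>\<close>, written with
  real inequalities so that closedness and the cone laws need no extended reals.\<close>

definition epi_cone :: "(real^'n) set \<Rightarrow> ('k::finite \<Rightarrow> real^'n) \<Rightarrow> 'k \<Rightarrow> ((real^'k) \<times> real) set" where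
  "epi_cone X A \<beta> = {(\<nu>, \<tau>). \<nu> \<in> Nset \<beta> \<and> (\<forall>x\<in>X. - (Amul A \<nu> \<bullet> x) \<le> \<tau>)}"

lemma Amul_add: "Amul A (\<mu> + \<nu>) = Amul A \<mu> + Amul A \<nu>"
  by (simp add: Amul_def scaleR_add_left sum.distrib)

lemma Amul_scaleR: "Amul A (c *\<^sub>R \<nu>) = c *\<^sub>R Amul A \<nu>"
  by (simp add: Amul_def scaleR_sum_right)

lemma inner_Amul: "Amul A \<nu> \<bullet> x = (\<Sum>k\<in>UNIV. \<nu> $ k * (A k \<bullet> x))"
  by (simp add: Amul_def inner_sum_left)

lemma convex_cone_Nset: "convex_cone (Nset \<beta>)"
  unfolding convex_cone_iff Nset_def
  by (auto simp: sum.distrib sum_distrib_left[symmetric])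

lemma Nset_nonzero_imp_neg:
  assumes "\<nu> \<in> Nset \<beta>" "\<nu> \<noteq> 0"
  shows "\<nu> $ \<beta> < 0"
proof (rule ccontr)
  assume "\<not> \<nu> $ \<beta> < 0"
  then have "\<forall>k. \<nu> $ k \<ge> 0" "(\<Sum>k\<in>UNIV. \<nu> $ k) = 0"
    using assms by (auto simp: Nset_def not_less)
  then have "\<nu> = 0"
    by (simp add: sum_nonneg_eq_0_iff vec_eq_iff)
  with assms show False by simp
qed

lemma closed_epi_cone: "closed (epi_cone X A \<beta>)"
proof -
  have "epi_cone X A \<beta> = {p. (\<forall>k. k \<noteq> \<beta> \<longrightarrow> 0 \<le> fst p $ k) \<and> (\<Sum>k\<in>UNIV. fst p $ k) = 0 \<and>
      (\<forall>x. x \<in> X \<longrightarrow> - (\<Sum>k\<in>UNIV. fst p $ k * (A k \<bullet> x)) \<le> snd p)}"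
    by (auto simp: epi_cone_def Nset_def inner_Amul)
  also have "closed \<dots>"
    by (intro closed_Collect_conj closed_Collect_all closed_Collect_imp
        closed_Collect_le closed_Collect_eq continuous_intros open_Collect_const)
  finally show ?thesis .
qed

text \<open>This is sublinearity of the support function, expressed through its real upper
  bounds.\<close>

lemma convex_cone_epi_cone: "convex_cone (epi_cone X A \<beta>)"
proof -
  have "- (Amul A (\<mu> + \<nu>) \<bullet> x) \<le> s + t"
    if "\<forall>x\<in>X. - (Amul A \<mu> \<bullet> x) \<le> s" "\<forall>x\<in>X. - (Amul A \<nu> \<bullet> x) \<le> t" "x \<in> X" for \<mu> \<nu> s t x
    using that by (force simp: Amul_add inner_add_left)
  moreover have "- (Amul A (c *\<^sub>R \<nu>) \<bullet> x) \<le> c * t"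
    if "\<forall>x\<in>X. - (Amul A \<nu> \<bullet> x) \<le> t" "x \<in> X" "c \<ge> 0" for \<nu> t x c
    using mult_left_mono[of "- (Amul A \<nu> \<bullet> x)" t c] that by (simp add: Amul_scaleR)
  moreover have "Amul A 0 = 0" by (simp add: Amul_def)
  ultimately show ?thesis
    using convex_cone_Nset[of \<beta>] unfolding convex_cone_iff epi_cone_def
    by (auto simp: zero_prod_def)
qed

lemma vertical_in_epi_cone: "X \<noteq> {} \<Longrightarrow> (0, \<tau>) \<in> epi_cone X A \<beta> \<longleftrightarrow> \<tau> \<ge> 0"
  by (auto simp: epi_cone_def Nset_def Amul_def)

lemma supp_fn_le_iff: "supp_fn X y \<le> ereal \<tau> \<longleftrightarrow> (\<forall>x\<in>X. y \<bullet> x \<le> \<tau>)"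
  by (simp add: supp_fn_def SUP_le_iff)

lemma epi_cone_iff_supp_fn:
  "(\<nu>, \<tau>) \<in> epi_cone X A \<beta> \<longleftrightarrow> \<nu> \<in> Nset \<beta> \<and> supp_fn X (- Amul A \<nu>) \<le> ereal \<tau>"
  by (auto simp: epi_cone_def supp_fn_le_iff)

text \<open>A point of \<open>X\<close> rules out the value minus infinity.\<close>

lemma supp_fn_eq_ereal:
  assumes "X \<noteq> {}" "supp_fn X y < \<infinity>"
  shows "supp_fn X y = ereal (real_of_ereal (supp_fn X y))"
proof -
  obtain x where "x \<in> X" using assms by blast
  then have "ereal (y \<bullet> x) \<le> supp_fn X y"
    by (auto simp: supp_fn_def intro: SUP_upper)
  then show ?thesis using assms by (cases "supp_fn X y") auto
qed

lemma phi_in_epi_cone: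
  assumes "X \<noteq> {}" "\<nu> \<in> Nset \<beta>" "supp_fn X (- Amul A \<nu>) < \<infinity>"
  shows "phi X A \<nu> \<in> epi_cone X A \<beta>"
  unfolding phi_def epi_cone_iff_supp_fn using assms supp_fn_eq_ereal[OF assms(1,3)] by simp

text \<open>Upper bounds scale by \<open>c\<close>; the reverse inequality scales a bound for
  \<open>c *\<^sub>R y\<close> back by \<open>1 / c\<close>.\<close>

lemma supp_fn_scaleR:
  assumes "c > 0" "X \<noteq> {}" "supp_fn X y = ereal s"
  shows "supp_fn X (c *\<^sub>R y) = ereal (c * s)"
proof (rule antisym)
  have y: "\<forall>x\<in>X. y \<bullet> x \<le> s" using assms(3) supp_fn_le_iff[of X y s] by simp
  then show le: "supp_fn X (c *\<^sub>R y) \<le> ereal (c * s)"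
    using assms(1) by (simp add: supp_fn_le_iff)
  then have "supp_fn X (c *\<^sub>R y) < \<infinity>" by (cases "supp_fn X (c *\<^sub>R y)") auto
  from supp_fn_eq_ereal[OF assms(2) this] obtain r where r: "supp_fn X (c *\<^sub>R y) = ereal r" by blast
  then have "\<forall>x\<in>X. (c *\<^sub>R y) \<bullet> x \<le> r" using supp_fn_le_iff[of X "c *\<^sub>R y" r] by simp
  then have "\<forall>x\<in>X. y \<bullet> x \<le> r / c" using assms(1) by (simp add: field_simps)
  then have "supp_fn X y \<le> ereal (r / c)" by (simp add: supp_fn_le_iff)
  then show "ereal (c * s) \<le> supp_fn X (c *\<^sub>R y)"
    using assms r by (simp add: field_simps)
qed

lemma phi_scaleR:
  assumes "c > 0" "X \<noteq> {}" "supp_fn X (- Amul A \<nu>) < \<infinity>"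
  shows "phi X A (c *\<^sub>R \<nu>) = c *\<^sub>R phi X A \<nu>" "supp_fn X (- Amul A (c *\<^sub>R \<nu>)) < \<infinity>"
  using supp_fn_scaleR[OF assms(1,2) supp_fn_eq_ereal[OF assms(2,3)]]
  by (simp_all add: phi_def Amul_scaleR)

lemma Lambda_XE:
  assumes "lam \<in> Lambda_X X A"
  obtains \<beta> where "lam \<in> Nset \<beta>" "lam $ \<beta> = -1" "supp_fn X (- Amul A lam) < \<infinity>" "lam \<noteq> 0"
  using assms by (auto simp: Lambda_X_def X_circuit_def)

text \<open>A nonvertical extreme ray lies on the graph of the support function. A decomposition
  violating the circuit condition would lift, by affinity, to a segment of the epigraph crossing the
  ray.\<close>

lemma extreme_ray_epi_cone:
  assumes X: "X \<noteq> {}" and p: "p \<in> epi_cone X A \<beta>"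
    and face: "{t *\<^sub>R p | t. t \<ge> 0} face_of (epi_cone X A \<beta>)"
  shows "(\<exists>t\<ge>0. p = t *\<^sub>R (0, 1)) \<or> (\<exists>lam\<in>Lambda_X X A. \<exists>t>0. p = t *\<^sub>R phi X A lam)"
proof (cases "fst p = 0")
  case True
  then have "p = snd p *\<^sub>R (0, 1)" by (simp add: prod_eq_iff)
  moreover have "snd p \<ge> 0"
    using p vertical_in_epi_cone[OF X, of "snd p" A \<beta>] True by (metis prod.collapse)
  ultimately show ?thesis by blast
next
  case False
  obtain \<nu> \<tau> where p_eq: "p = (\<nu>, \<tau>)" by fastforce
  have nu: "\<nu> \<noteq> 0" "\<nu> \<in> Nset \<beta>" "supp_fn X (- Amul A \<nu>) \<le> ereal \<tau>"
    using False p by (auto simp: p_eq epi_cone_iff_supp_fn)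
  then have fin: "supp_fn X (- Amul A \<nu>) < \<infinity>"
    by (cases "supp_fn X (- Amul A \<nu>)") auto
  obtain s where s: "supp_fn X (- Amul A \<nu>) = ereal s"
    using supp_fn_eq_ereal[OF X fin] by blast
  \<comment> \<open>A point strictly above the graph is the midpoint of \<open>(\<nu>, s)\<close>
    and its mirror image \<open>(\<nu>, 2 * \<tau> - s)\<close>, so the face property would put
    \<open>(\<nu>, s)\<close> on the ray.\<close>
  have "\<tau> = s"
  proof (rule ccontr)
    assume "\<tau> \<noteq> s"
    then have "s < \<tau>" using nu s by simp
    have "(\<nu>, s) \<in> epi_cone X A \<beta>" "(\<nu>, 2 * \<tau> - s) \<in> epi_cone X A \<beta>"
      using nu s \<open>s < \<tau>\<close> by (auto simp: epi_cone_iff_supp_fn)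
    moreover have "p \<in> open_segment (\<nu>, s) (\<nu>, 2 * \<tau> - s)"
      using \<open>s < \<tau>\<close>
      by (auto simp: p_eq in_segment scaleR_add_left[symmetric] diff_divide_distrib
          intro!: exI[of _ "1/2"])
    moreover have "p \<in> {t *\<^sub>R p | t. t \<ge> 0}"
      by (auto intro!: exI[of _ 1])
    ultimately have "(\<nu>, s) \<in> {t *\<^sub>R p | t. t \<ge> 0}"
      using face_ofD[OF face] by blast
    then obtain t where "\<nu> = t *\<^sub>R \<nu>" "s = t * \<tau>" by (auto simp: p_eq)
    then show False
      using nu(1) \<open>s < \<tau>\<close> by (metis less_irrefl mult_1 scaleR_cancel_right scaleR_one)
  qed
  then have p_phi: "p = phi X A \<nu>" by (simp add: p_eq phi_def s)
  define r where "r = - (\<nu> $ \<beta>)"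
  define lam where "lam = (1 / r) *\<^sub>R \<nu>"
  have r: "r > 0" using Nset_nonzero_imp_neg nu by (auto simp: r_def)
  have lam_phi: "phi X A lam = (1 / r) *\<^sub>R p" "supp_fn X (- Amul A lam) < \<infinity>"
    unfolding lam_def p_phi using phi_scaleR[OF _ X fin, of "1 / r"] r by auto
  have lam: "lam \<in> Nset \<beta>" "lam \<noteq> 0" "lam $ \<beta> = -1"
    using r nu convex_cone_scaleR[OF convex_cone_Nset, of "1 / r" \<nu> \<beta>]
    by (auto simp: lam_def r_def)
  have "X_circuit X A \<beta> lam"
    unfolding X_circuit_def
  proof (intro conjI lam lam_phi notI)
    assume "\<exists>\<nu>1 \<nu>2 \<theta>. \<nu>1 \<in> Nset \<beta> \<and> \<nu>2 \<in> Nset \<beta> \<and>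
          \<not> (\<exists>c. \<nu>1 = c *\<^sub>R \<nu>2) \<and> \<not> (\<exists>c. \<nu>2 = c *\<^sub>R \<nu>1) \<and>
          0 < \<theta> \<and> \<theta> < 1 \<and> lam = \<theta> *\<^sub>R \<nu>1 + (1 - \<theta>) *\<^sub>R \<nu>2 \<and>
          affine_on_seg X A \<nu>1 \<nu>2"
    then obtain \<nu>1 \<nu>2 \<theta> a b where N: "\<nu>1 \<in> Nset \<beta>" "\<nu>2 \<in> Nset \<beta>"
      and np: "\<not> (\<exists>c. \<nu>1 = c *\<^sub>R \<nu>2)" "\<not> (\<exists>c. \<nu>2 = c *\<^sub>R \<nu>1)"
      and th: "0 < \<theta>" "\<theta> < 1" and lam_eq: "lam = \<theta> *\<^sub>R \<nu>1 + (1 - \<theta>) *\<^sub>R \<nu>2"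
      and aff: "\<And>t. t \<in> {0..1} \<Longrightarrow>
        supp_fn X (- Amul A ((1 - t) *\<^sub>R \<nu>1 + t *\<^sub>R \<nu>2)) = ereal (a + b * t)"
      unfolding affine_on_seg_def by blast
    have s1: "supp_fn X (- Amul A \<nu>1) = ereal a" using aff[of 0] by simp
    have s2: "supp_fn X (- Amul A \<nu>2) = ereal (a + b)" using aff[of 1] by simp
    \<comment> \<open>The parameter in \<open>affine_on_seg\<close> is the weight of
      \<open>\<nu>2\<close>, hence \<open>1 - \<theta>\<close>.\<close>
    have s3: "supp_fn X (- Amul A lam) = ereal (a + b * (1 - \<theta>))"
      using aff[of "1 - \<theta>"] th by (simp add: lam_eq)
    have "phi X A lam \<in> open_segment (phi X A \<nu>1) (phi X A \<nu>2)"
    proof -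
      have "phi X A lam = (1 - (1 - \<theta>)) *\<^sub>R phi X A \<nu>1 + (1 - \<theta>) *\<^sub>R phi X A \<nu>2"
        by (simp add: phi_def s1 s2 s3) (simp add: lam_eq algebra_simps)
      moreover have "phi X A \<nu>1 \<noteq> phi X A \<nu>2"
        using np(1) by (auto simp: phi_def) (metis scaleR_one)
      ultimately show ?thesis
        using th unfolding in_segment by (metis diff_gt_0_iff_gt diff_less_eq less_add_same_cancel1)
    qed
    moreover have "phi X A \<nu>1 \<in> epi_cone X A \<beta>" "phi X A \<nu>2 \<in> epi_cone X A \<beta>"
      using N s1 s2 X by (auto intro: phi_in_epi_cone)
    moreover have "phi X A lam \<in> {t *\<^sub>R p | t. t \<ge> 0}"
      using r by (auto simp: lam_phi intro!: exI[of _ "1 / r"])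
    ultimately have "phi X A \<nu>1 \<in> {t *\<^sub>R p | t. t \<ge> 0}" "phi X A \<nu>2 \<in> {t *\<^sub>R p | t. t \<ge> 0}"
      using face_ofD[OF face] by blast+
    then obtain t1 t2 where t: "\<nu>1 = t1 *\<^sub>R \<nu>" "\<nu>2 = t2 *\<^sub>R \<nu>"
      by (auto simp: phi_def p_eq)
    show False
    \<comment> \<open>Either \<open>\<nu>1\<close> vanishes or \<open>\<nu>2\<close> is a multiple
      of it; each contradicts one half of nonproportionality.\<close>
    proof (cases "t1 = 0")
      case True
      then show False using np(1) t by (metis scaleR_zero_left)
    next
      case False
      then have "\<nu>2 = (t2 / t1) *\<^sub>R \<nu>1" using t by simp
      then show False using np(2) by blast
    qed
  qed
  then have "lam \<in> Lambda_X X A" using lam by (auto simp: Lambda_X_def)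
  moreover have "p = r *\<^sub>R phi X A lam" using r by (simp add: lam_phi)
  ultimately show ?thesis using r by blast
qed

section \<open>Weighted arithmetic-geometric means\<close>

text \<open>Entries other than \<open>\<beta>\<close> are nonnegative, so those missing from the
  right-hand sum are 0.\<close>

lemma Nset_sum_split:
  assumes "\<nu> \<in> Nset \<beta>" "\<nu> $ \<beta> = -1"
  shows "(\<Sum>k\<in>UNIV. \<nu> $ k * g k) = (\<Sum>k | \<nu> $ k > 0. \<nu> $ k * g k) - g \<beta>"
proof -
  have "(\<Sum>k\<in>UNIV. \<nu> $ k * g k) = (\<Sum>k\<in>insert \<beta> {k. \<nu> $ k > 0}. \<nu> $ k * g k)"
    using assms by (intro sum.mono_neutral_right) (auto simp: Nset_def less_le)
  also have "\<dots> = (\<Sum>k | \<nu> $ k > 0. \<nu> $ k * g k) - g \<beta>"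
    using assms by (subst sum.insert) auto
  finally show ?thesis .
qed

lemma Nset_sum_pos:
  assumes "\<nu> \<in> Nset \<beta>" "\<nu> $ \<beta> = -1"
  shows "(\<Sum>k | \<nu> $ k > 0. \<nu> $ k) = 1"
  using Nset_sum_split[OF assms, of "\<lambda>_. 1"] assms by (simp add: Nset_def)

lemma signomial_inner: "signomial A c x = (\<chi> k. exp (A k \<bullet> x)) \<bullet> c"
  by (simp add: signomial_def inner_vec_def mult.commute)

text \<open>The positive entries of \<open>\<nu>\<close> are weights with sum 1, so Jensen's
  inequality for \<open>exp\<close> bounds the positive terms below by one exponential. The epigraph
  condition compares its exponent with \<open>A \<beta> \<bullet> x - s\<close>.\<close>

lemma C_beta_amgm:
  assumes nu: "(\<nu>, s) \<in> epi_cone X A \<beta>" "\<nu> $ \<beta> = -1"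
    and c: "\<And>k. k \<noteq> \<beta> \<Longrightarrow> c $ k \<ge> 0" "\<And>k. \<nu> $ k > 0 \<Longrightarrow> c $ k > 0"
    and c_beta: "- c $ \<beta> \<le> exp ((\<Sum>k | \<nu> $ k > 0. \<nu> $ k * ln (c $ k / \<nu> $ k)) - s)"
  shows "c \<in> C_beta X A \<beta>"
proof -
  let ?P = "{k. \<nu> $ k > 0}"
  let ?L = "\<Sum>k\<in>?P. \<nu> $ k * ln (c $ k / \<nu> $ k)"
  have N: "\<nu> \<in> Nset \<beta>" using nu by (simp add: epi_cone_def)
  have P: "?P \<noteq> {}" using Nset_sum_pos[OF N nu(2)] by (metis sum.empty zero_neq_one)
  have "signomial A c x \<ge> 0" if x: "x \<in> X" for x
  proof -
    have "- (Amul A \<nu> \<bullet> x) \<le> s" using nu x by (auto simp: epi_cone_def)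
    then have A: "(\<Sum>k\<in>?P. \<nu> $ k * (A k \<bullet> x)) \<ge> A \<beta> \<bullet> x - s"
      unfolding inner_Amul Nset_sum_split[OF N nu(2)] by simp
    have "- c $ \<beta> * exp (A \<beta> \<bullet> x) \<le> exp (?L - s) * exp (A \<beta> \<bullet> x)"
      using c_beta by (intro mult_right_mono) auto
    also have "\<dots> = exp (?L + (A \<beta> \<bullet> x - s))"
      by (simp add: exp_add[symmetric])
    also have "\<dots> \<le> exp (?L + (\<Sum>k\<in>?P. \<nu> $ k * (A k \<bullet> x)))"
      using A by simp
    also have "\<dots> = exp (\<Sum>k\<in>?P. \<nu> $ k *\<^sub>R (ln (c $ k / \<nu> $ k) + A k \<bullet> x))"
      by (simp add: sum.distrib distrib_left)
    also have "\<dots> \<le> (\<Sum>k\<in>?P. \<nu> $ k * exp (ln (c $ k / \<nu> $ k) + A k \<bullet> x))"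
      using P Nset_sum_pos[OF N nu(2)] by (intro convex_on_sum[OF _ _ exp_convex]) auto
    also have "\<dots> = (\<Sum>k\<in>?P. c $ k * exp (A k \<bullet> x))"
      using c(2) by (intro sum.cong) (auto simp: exp_add exp_ln)
    also have "\<dots> \<le> (\<Sum>k\<in>UNIV - {\<beta>}. c $ k * exp (A k \<bullet> x))"
      using c(1) nu(2) by (intro sum_mono2) auto
    also have "\<dots> = signomial A c x - c $ \<beta> * exp (A \<beta> \<bullet> x)"
      by (simp add: signomial_def sum_diff1)
    finally show ?thesis by simp
  qed
  then show ?thesis using c(1) by (auto simp: C_beta_def)
qed

lemma nonneg_in_C_beta: "(\<And>k. c $ k \<ge> 0) \<Longrightarrow> c \<in> C_beta X A \<beta>"
  by (auto simp: C_beta_def signomial_def intro!: sum_nonneg)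

lemma prod_powr_eq_exp:
  fixes f :: "'a \<Rightarrow> real"
  assumes "finite P" "\<And>k. k \<in> P \<Longrightarrow> f k > 0"
  shows "(\<Prod>k\<in>P. f k powr g k) = exp (\<Sum>k\<in>P. g k * ln (f k))"
proof -
  have "(\<Prod>k\<in>P. f k powr g k) = (\<Prod>k\<in>P. exp (g k * ln (f k)))"
    using assms(2) by (intro prod.cong refl) (metis less_irrefl powr_def)
  then show ?thesis using assms(1) by (simp add: exp_sum)
qed

text \<open>A vector with \<open>c $ \<beta>\<close> nonnegative is a nonnegative signomial;
  otherwise the product inequality is an AM-GM certificate.\<close>

lemma C_lambda_subset_C_beta:
  assumes X: "X \<noteq> {}" and lam: "lam \<in> Lambda_X X A"
  shows "C_lambda X A lam \<subseteq> (\<Union>\<beta>. C_beta X A \<beta>)"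
proof
  fix c assume c: "c \<in> C_lambda X A lam"
  let ?s = "real_of_ereal (supp_fn X (- Amul A lam))"
  obtain \<beta> where b: "lam \<in> Nset \<beta>" "lam $ \<beta> = -1" "supp_fn X (- Amul A lam) < \<infinity>"
    using lam by (rule Lambda_XE)
  have epi: "(lam, ?s) \<in> epi_cone X A \<beta>"
    using phi_in_epi_cone[OF X b(1,3)] by (simp add: phi_def)
  obtain \<beta>' where b': "lam $ \<beta>' < 0" "\<And>k. k \<noteq> \<beta>' \<Longrightarrow> c $ k \<ge> 0"
    "(\<Prod>k\<in>{k. lam $ k > 0}. (c $ k / lam $ k) powr (lam $ k)) \<ge> - c $ \<beta>' * exp ?s"
    using c by (auto simp: C_lambda_def)
  have "\<beta>' = \<beta>" using b(1) b'(1) by (force simp: Nset_def)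
  note b' = b'[unfolded this]
  have "c \<in> C_beta X A \<beta>"
  proof (cases "c $ \<beta> \<ge> 0")
    case True
    then show ?thesis using b'(2) nonneg_in_C_beta by metis
  next
    case False
    \<comment> \<open>The product is then positive. As \<open>0 powr a = 0\<close>, none of its
      factors vanishes, and logarithms can be taken.\<close>
    then have "0 < - c $ \<beta> * exp ?s" by (simp add: mult_neg_pos)
    then have "(\<Prod>k\<in>{k. lam $ k > 0}. (c $ k / lam $ k) powr (lam $ k)) \<noteq> 0"
      using b'(3) by linarith
    then have ck: "c $ k > 0" if "lam $ k > 0" for k
      using that b(2) b'(2)[of k] by (fastforce simp: less_le)
    then have "- c $ \<beta> * exp ?s \<le> exp (\<Sum>k | lam $ k > 0. lam $ k * ln (c $ k / lam $ k))"
      using b'(3) prod_powr_eq_exp[of "{k. lam $ k > 0}" "\<lambda>k. c $ k / lam $ k" "\<lambda>k. lam $ k"]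
      by simp
    then have "- c $ \<beta> \<le> exp ((\<Sum>k | lam $ k > 0. lam $ k * ln (c $ k / lam $ k)) - ?s)"
      by (simp add: exp_diff field_simps)
    then show ?thesis
      using C_beta_amgm[OF epi b(2)] b'(2) ck by blast
  qed
  then show "c \<in> (\<Union>\<beta>. C_beta X A \<beta>)" by blast
qed


text \<open>Among the AM-GM certificates with weights \<open>\<nu>\<close> and offset \<open>s\<close>, normalized so that the
  entries other than \<open>\<beta>\<close> contribute 1 to \<open>v \<bullet> c\<close>, this one minimizes \<open>v \<bullet> c\<close>.\<close>

definition age_witness :: "'k::finite \<Rightarrow> real^'k \<Rightarrow> real \<Rightarrow> real^'k \<Rightarrow> real^'k" where
  "age_witness \<beta> \<nu> s v = (\<chi> k. if k = \<beta>
     then - exp ((\<Sum>k | \<nu> $ k > 0. \<nu> $ k * ln (1 / v $ k)) - s) else \<nu> $ k / v $ k)"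

text \<open>The ratios \<open>c $ k / \<nu> $ k\<close> on the support are \<open>1 / v $ k\<close>,
  so the AM-GM condition holds with equality.\<close>

lemma age_witness_in_C_beta:
  assumes nu: "(\<nu>, s) \<in> epi_cone X A \<beta>" "\<nu> $ \<beta> = -1" and v: "\<And>k. v $ k > 0"
  shows "age_witness \<beta> \<nu> s v \<in> C_beta X A \<beta>"
proof (rule C_beta_amgm[OF nu])
  let ?c = "age_witness \<beta> \<nu> s v"
  have N: "\<nu> \<in> Nset \<beta>" using nu by (simp add: epi_cone_def)
  show "?c $ k \<ge> 0" if "k \<noteq> \<beta>" for k
    using that v[of k] N by (auto simp: age_witness_def Nset_def)
  show "?c $ k > 0" if "\<nu> $ k > 0" for k
    using that v[of k] nu(2) by (auto simp: age_witness_def)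
  have "(\<Sum>k | \<nu> $ k > 0. \<nu> $ k * ln (?c $ k / \<nu> $ k)) = (\<Sum>k | \<nu> $ k > 0. \<nu> $ k * ln (1 / v $ k))"
    using nu(2) by (intro sum.cong) (auto simp: age_witness_def)
  then show "- ?c $ \<beta> \<le> exp ((\<Sum>k | \<nu> $ k > 0. \<nu> $ k * ln (?c $ k / \<nu> $ k)) - s)"
    by (simp add: age_witness_def)
qed

lemma age_witness_in_C_lambda:
  assumes N: "lam \<in> Nset \<beta>" "lam $ \<beta> = -1" and v: "\<And>k. v $ k > 0"
  shows "age_witness \<beta> lam (real_of_ereal (supp_fn X (- Amul A lam))) v \<in> C_lambda X A lam"
proof -
  let ?s = "real_of_ereal (supp_fn X (- Amul A lam))"
  let ?c = "age_witness \<beta> lam ?s v"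
  have "?c $ k \<ge> 0" if "k \<noteq> \<beta>" for k
    using that v[of k] N by (auto simp: age_witness_def Nset_def)
  moreover have "(\<Prod>k | lam $ k > 0. (?c $ k / lam $ k) powr (lam $ k)) =
      (\<Prod>k | lam $ k > 0. (1 / v $ k) powr (lam $ k))"
    using N(2) by (intro prod.cong) (auto simp: age_witness_def)
  then have "(\<Prod>k | lam $ k > 0. (?c $ k / lam $ k) powr (lam $ k)) =
      exp (\<Sum>k | lam $ k > 0. lam $ k * ln (1 / v $ k))"
    using prod_powr_eq_exp[of "{k. lam $ k > 0}" "\<lambda>k. 1 / v $ k"] v by simp
  then have "(\<Prod>k | lam $ k > 0. (?c $ k / lam $ k) powr (lam $ k)) \<ge> - ?c $ \<beta> * exp ?s"
    by (simp add: age_witness_def exp_diff)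
  ultimately show ?thesis
    unfolding C_lambda_def using N(2) by (intro CollectI exI[of _ \<beta>]) simp
qed

text \<open>The entries off \<open>\<beta>\<close> contribute 1 in total, and the entry at
  \<open>\<beta>\<close> gives the exponential. So \<open>v \<bullet> c\<close> has the sign of
  \<open>(ln v, 1)\<close> at \<open>(\<nu>, s)\<close>, which links duality for signomials with
  duality for epigraphs.\<close>

lemma inner_age_witness:
  assumes N: "\<nu> \<in> Nset \<beta>" "\<nu> $ \<beta> = -1" and v: "\<And>k. v $ k > 0"
  shows "v \<bullet> age_witness \<beta> \<nu> s v = 1 - exp (- (((\<chi> k. ln (v $ k)), 1) \<bullet> (\<nu>, s)))"
proof -
  let ?c = "age_witness \<beta> \<nu> s v"
  have vc: "v $ k * ?c $ k = \<nu> $ k" if "k \<noteq> \<beta>" for k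
    using that v[of k] by (simp add: age_witness_def)
  have lnv: "ln (1 / v $ k) = - ln (v $ k)" for k
    using v[of k] by (simp add: ln_div)
  have "v \<bullet> ?c = (\<Sum>k\<in>UNIV - {\<beta>}. v $ k * ?c $ k) + v $ \<beta> * ?c $ \<beta>"
    by (simp add: inner_vec_def sum_diff1)
  also have "(\<Sum>k\<in>UNIV - {\<beta>}. v $ k * ?c $ k) = (\<Sum>k\<in>UNIV - {\<beta>}. \<nu> $ k)"
    by (intro sum.cong) (auto simp: vc)
  also have "\<dots> = 1"
    using N by (simp add: sum_diff1 Nset_def)
  also have "v $ \<beta> * ?c $ \<beta> =
      - (exp (ln (v $ \<beta>)) * exp ((\<Sum>k | \<nu> $ k > 0. \<nu> $ k * ln (1 / v $ k)) - s))"
    using v by (simp add: age_witness_def)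
  also have "\<dots> = - exp (- (((\<Sum>k | \<nu> $ k > 0. \<nu> $ k * ln (v $ k)) - ln (v $ \<beta>)) + s))"
    unfolding mult_exp_exp lnv by (simp add: sum_negf algebra_simps)
  also have "(\<Sum>k | \<nu> $ k > 0. \<nu> $ k * ln (v $ k)) - ln (v $ \<beta>) = (\<chi> k. ln (v $ k)) \<bullet> \<nu>"
    using Nset_sum_split[OF N, of "\<lambda>k. ln (v $ k)"] by (simp add: inner_vec_def mult.commute)
  finally show ?thesis by simp
qed

section \<open>Strictly positive functionals from linear independence\<close>

text \<open>The functional is a sum of point evaluations forming a basis. If it vanishes on a
  signomial nonnegative on \<open>X\<close>, each of these evaluations does, and the coefficients
  are orthogonal to the whole space.\<close>

lemma strictly_positive_functional_exists:
  fixes A :: "'k::finite \<Rightarrow> real^'n"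
  assumes "\<forall>c::real^'k. (\<forall>x\<in>X. (\<Sum>k\<in>UNIV. c $ k * exp (A k \<bullet> x)) = 0) \<longrightarrow> c = 0"
  obtains v :: "real^'k" where "\<And>k. v $ k > 0"
    and "\<And>c. c \<noteq> 0 \<Longrightarrow> (\<And>x. x \<in> X \<Longrightarrow> signomial A c x \<ge> 0) \<Longrightarrow> v \<bullet> c > 0"
proof -
  let ?e = "\<lambda>x. (\<chi> k. exp (A k \<bullet> x)) :: real^'k"
  \<comment> \<open>The normal of a hyperplane containing all evaluations would be a nonzero
    signomial vanishing on \<open>X\<close>.\<close>
  have "span (?e ` X) = UNIV"
  proof (rule ccontr)
    assume "span (?e ` X) \<noteq> UNIV"
    then obtain a where a: "a \<noteq> 0" "span (?e ` X) \<subseteq> {y. a \<bullet> y = 0}"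
      using span_not_univ_subset_hyperplane by blast
    have "signomial A a x = 0" if "x \<in> X" for x
    proof -
      have "?e x \<in> span (?e ` X)" using that by (intro span_base) auto
      then show ?thesis using a(2) by (auto simp: signomial_inner inner_commute)
    qed
    then show False using assms a(1) by (auto simp: signomial_def)
  qed
  moreover obtain B where B: "B \<subseteq> ?e ` X" "independent B" "?e ` X \<subseteq> span B"
    using maximal_independent_subset[of "?e ` X"] by blast
  ultimately have span: "span B = UNIV"
    using span_minimal[OF B(3) subspace_span] by blast
  have fin: "finite B" using B(2) by (rule independent_imp_finite)
  define v where "v = \<Sum>B"
  have pos: "v \<bullet> c > 0" if "c \<noteq> 0" and c: "\<And>x. x \<in> X \<Longrightarrow> signomial A c x \<ge> 0" for c
  proof (rule ccontr)
    assume "\<not> v \<bullet> c > 0"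
    moreover have nn: "b \<bullet> c \<ge> 0" if "b \<in> B" for b
      using that B(1) c by (auto simp: signomial_inner)
    moreover have "v \<bullet> c = (\<Sum>b\<in>B. b \<bullet> c)" by (simp add: v_def inner_sum_left)
    ultimately have "(\<Sum>b\<in>B. b \<bullet> c) = 0"
      by (metis linorder_not_less order_antisym sum_nonneg)
    then have "\<forall>b\<in>B. b \<bullet> c = 0" using nn fin by (simp add: sum_nonneg_eq_0_iff)
    then have "orthogonal c c"
      using span by (intro orthogonal_to_span[of c B]) (auto simp: orthogonal_def inner_commute)
    then show False using \<open>c \<noteq> 0\<close> by (simp add: orthogonal_def)
  qed
  \<comment> \<open>A single exponential is a nonzero signomial nonnegative on
    \<open>X\<close>.\<close>
  moreover have "v $ k > 0" for k
  proof -
    have "v \<bullet> axis k 1 > 0"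
      by (rule pos) (auto simp: axis_eq_0_iff signomial_def, auto simp: axis_def intro!: sum_nonneg)
    then show ?thesis by (simp add: inner_axis)
  qed
  ultimately show ?thesis using that by blast
qed

text \<open>After normalization, the AM-GM witness of \<open>p\<close> is a nonzero signomial
  nonnegative on \<open>X\<close>; strict positivity of \<open>v\<close> on it carries over by
  \<open>inner_age_witness\<close>.\<close>

lemma epi_cone_pos:
  assumes X: "X \<noteq> {}" and v: "\<And>k. v $ k > 0"
    and pos: "\<And>c. c \<noteq> 0 \<Longrightarrow> (\<And>x. x \<in> X \<Longrightarrow> signomial A c x \<ge> 0) \<Longrightarrow> v \<bullet> c > 0"
    and p: "p \<in> epi_cone X A \<beta>" "p \<noteq> 0"
  shows "((\<chi> k. ln (v $ k)), 1) \<bullet> p > 0"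
proof (cases "fst p = 0")
  case True
  then obtain \<tau> where t: "p = (0, \<tau>)" by (cases p) auto
  then have "\<tau> \<ge> 0" "\<tau> \<noteq> 0"
    using p vertical_in_epi_cone[OF X, of \<tau> A \<beta>] by (auto simp: zero_prod_def)
  then show ?thesis by (simp add: t)
next
  case False
  let ?l = "((\<chi> k. ln (v $ k)), 1 :: real)"
  define r where "r = - (fst p $ \<beta>)"
  have "fst p \<in> Nset \<beta>" using p by (auto simp: epi_cone_def)
  then have r: "r > 0" using Nset_nonzero_imp_neg False by (auto simp: r_def)
  obtain \<nu> s where q: "(1 / r) *\<^sub>R p = (\<nu>, s)" by fastforce
  have nu: "(\<nu>, s) \<in> epi_cone X A \<beta>"
    unfolding q[symmetric] using r p by (intro convex_cone_scaleR[OF convex_cone_epi_cone]) auto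
  then have N: "\<nu> \<in> Nset \<beta>" by (simp add: epi_cone_def)
  have nb: "\<nu> $ \<beta> = -1"
  proof -
    have "\<nu> = (1 / r) *\<^sub>R fst p" using q by (metis fst_conv fst_scaleR)
    then show ?thesis using r by (simp add: r_def)
  qed
  let ?c = "age_witness \<beta> \<nu> s v"
  have "?c $ \<beta> \<noteq> 0" by (simp add: age_witness_def)
  then have "?c \<noteq> 0" by auto
  moreover have "?c \<in> C_beta X A \<beta>" by (rule age_witness_in_C_beta[OF nu nb v])
  ultimately have "v \<bullet> ?c > 0" by (intro pos) (auto simp: C_beta_def)
  then have "?l \<bullet> ((1 / r) *\<^sub>R p) > 0"
    unfolding inner_age_witness[OF N nb v] q by simp
  then show ?thesis using r by (simp add: zero_less_divide_iff)
qed

section \<open>Reduced circuits generate the epigraphs\<close>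

lemma closed_Union_epi_cone: "closed (\<Union>\<beta>. epi_cone X A \<beta>)"
  for A :: "'k::finite \<Rightarrow> real^'n"
  by (intro closed_UN) (auto intro: closed_epi_cone)

lemma conic_Union_epi_cone: "conic (\<Union>\<beta>. epi_cone X A \<beta>)"
  using convex_cone_epi_cone unfolding convex_cone_def conic_def by blast

text \<open>The generators of the graph lie in the epigraphs. Conversely, each epigraph is generated
  by its extreme rays, which are vertical or spanned by circuits.\<close>

lemma circuit_graph_eq:
  assumes X: "X \<noteq> {}" and pos: "\<And>\<beta> y. y \<in> epi_cone X A \<beta> \<Longrightarrow> y \<noteq> 0 \<Longrightarrow> 0 < l \<bullet> y"
  shows "circuit_graph X A = convex_cone hull (\<Union>\<beta>. epi_cone X A \<beta>)"
proof
  have "phi X A lam \<in> (\<Union>\<beta>. epi_cone X A \<beta>)" if lam: "lam \<in> Lambda_X X A" for lam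
    using lam by (rule Lambda_XE) (auto intro: phi_in_epi_cone[OF X])
  moreover have "(0, 1) \<in> (\<Union>\<beta>. epi_cone X A \<beta>)"
    using vertical_in_epi_cone[OF X, of 1 A] by (auto intro: zero_le_one)
  ultimately show "circuit_graph X A \<subseteq> convex_cone hull (\<Union>\<beta>. epi_cone X A \<beta>)"
    unfolding circuit_graph_def by (intro hull_mono) auto
  have gr: "convex_cone (circuit_graph X A)"
    by (simp add: circuit_graph_def convex_cone_convex_cone_hull)
  have gens: "(0, 1) \<in> circuit_graph X A" "\<And>lam. lam \<in> Lambda_X X A \<Longrightarrow> phi X A lam \<in> circuit_graph X A"
    unfolding circuit_graph_def by (auto intro: hull_inc)
  have "epi_cone X A \<beta> \<subseteq> circuit_graph X A" for \<beta>
  proof (rule conic_subset_if_extreme_points[where l = l])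
    let ?E = "epi_cone X A \<beta>"
    fix p assume p: "p extreme_point_of (convex hull (?E \<inter> {y. l \<bullet> y = 1}))"
    have con: "conic ?E" using convex_cone_epi_cone by (auto simp: convex_cone_def)
    have "convex_cone hull ?E = ?E" by (intro hull_same convex_cone_epi_cone)
    then have "{t *\<^sub>R p | t. t \<ge> 0} face_of ?E"
      using extreme_point_base_imp_extreme_ray[OF con pos p] by simp
    moreover have "p \<in> ?E" using extreme_point_of_convex_hull[OF p] by blast
    ultimately consider t where "t \<ge> 0" "p = t *\<^sub>R (0, 1)" |
      lam t where "lam \<in> Lambda_X X A" "t > 0" "p = t *\<^sub>R phi X A lam"
      using extreme_ray_epi_cone[OF X] by blast
    then show "p \<in> circuit_graph X A"
      using gens by cases (auto intro!: convex_cone_scaleR[OF gr] simp del: scaleR_Pair)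
  qed (use convex_cone_epi_cone gr pos in \<open>auto simp: convex_cone_def closed_epi_cone\<close>)
  then show "convex_cone hull (\<Union>\<beta>. epi_cone X A \<beta>) \<subseteq> circuit_graph X A"
    using gr by (intro hull_minimal) auto
qed

text \<open>Krein-Milman is applied to the union of the epigraphs, not to each one: extreme points
  of the common base span extreme rays of the whole graph, so the circuits that arise are
  reduced.\<close>

lemma epi_cone_subset_if_reduced_circuits:
  assumes X: "X \<noteq> {}" and pos: "\<And>\<beta> y. y \<in> epi_cone X A \<beta> \<Longrightarrow> y \<noteq> 0 \<Longrightarrow> 0 < l \<bullet> y"
    and K: "convex_cone K" "(0, 1) \<in> K"
    and star: "\<And>lam. lam \<in> Lambda_X_star X A \<Longrightarrow> phi X A lam \<in> K"
  shows "epi_cone X A \<beta> \<subseteq> K"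
proof -
  let ?E = "\<Union>\<beta>. epi_cone X A \<beta>"
  have pos': "0 < l \<bullet> y" if "y \<in> ?E" "y \<noteq> 0" for y using that pos by blast
  have graph: "circuit_graph X A = convex_cone hull ?E"
    using X pos by (rule circuit_graph_eq)
  have "?E \<subseteq> K"
  proof (rule conic_subset_if_extreme_points[OF closed_Union_epi_cone conic_Union_epi_cone pos' K(1)])
    fix p assume p: "p extreme_point_of (convex hull (?E \<inter> {y. l \<bullet> y = 1}))"
    have face: "{t *\<^sub>R p | t. t \<ge> 0} face_of circuit_graph X A"
      using extreme_point_base_imp_extreme_ray[OF conic_Union_epi_cone pos' p]
      unfolding graph by blast
    obtain \<beta> where pb: "p \<in> epi_cone X A \<beta>"
      using extreme_point_of_convex_hull[OF p] by blast
    \<comment> \<open>A face of the graph lying in one epigraph is a face of that epigraph, so the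
      classification of its extreme rays applies.\<close>
    have "{t *\<^sub>R p | t. t \<ge> 0} \<subseteq> epi_cone X A \<beta>"
      using convex_cone_scaleR[OF convex_cone_epi_cone] pb by blast
    moreover have "epi_cone X A \<beta> \<subseteq> circuit_graph X A"
      unfolding graph by (rule order_trans[OF _ hull_subset]) blast
    ultimately have "{t *\<^sub>R p | t. t \<ge> 0} face_of epi_cone X A \<beta>"
      using face_of_subset[OF face] by blast
    then consider t where "t \<ge> 0" "p = t *\<^sub>R (0, 1)" |
      lam t where "lam \<in> Lambda_X X A" "t > 0" "p = t *\<^sub>R phi X A lam"
      using extreme_ray_epi_cone[OF X pb] by blast
    then show "p \<in> K"
    proof cases
      case 1
      then show ?thesis using K convex_cone_scaleR by blast
    next
      case 2
      have "{u *\<^sub>R p | u. u \<ge> 0} = {u *\<^sub>R phi X A lam | u. u \<ge> 0}" (is "?R = ?S")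
      proof
        have "u *\<^sub>R p = (u * t) *\<^sub>R phi X A lam" for u using 2 by simp
        moreover have "u \<ge> 0 \<Longrightarrow> u * t \<ge> 0" for u using 2 by simp
        ultimately show "?R \<subseteq> ?S" by blast
        have "u *\<^sub>R phi X A lam = (u / t) *\<^sub>R p" for u using 2 by simp
        moreover have "u \<ge> 0 \<Longrightarrow> u / t \<ge> 0" for u using 2 by simp
        ultimately show "?S \<subseteq> ?R" by blast
      qed
      then have "lam \<in> Lambda_X_star X A"
        using face 2 by (simp add: Lambda_X_star_def)
      then show ?thesis using star K 2 convex_cone_scaleR[OF K(1)] by (simp add: less_imp_le)
    qed
  qed
  then show ?thesis by blast
qed

text \<open>Without reduced circuits all epigraphs would lie in the vertical line, but a circuit
  gives a point off it.\<close>

lemma Lambda_X_star_nonempty: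
  assumes X: "X \<noteq> {}" and pos: "\<And>\<beta> y. y \<in> epi_cone X A \<beta> \<Longrightarrow> y \<noteq> 0 \<Longrightarrow> 0 < l \<bullet> y"
    and "Lambda_X X A \<noteq> {}"
  shows "Lambda_X_star X A \<noteq> {}"
proof
  assume empty: "Lambda_X_star X A = {}"
  obtain lam \<beta> where lam: "lam \<in> Nset \<beta>" "supp_fn X (- Amul A lam) < \<infinity>" "lam \<noteq> 0"
    using assms(3) Lambda_XE by (metis ex_in_conv)
  have "epi_cone X A \<beta> \<subseteq> {p. fst p = 0}"
    by (rule epi_cone_subset_if_reduced_circuits[OF X pos])
      (auto simp: convex_cone_iff empty)
  then show False
    using phi_in_epi_cone[OF X lam(1,2)] lam(3) by (auto simp: phi_def)
qed

section \<open>The dual cone\<close>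

text \<open>Normals separating a point from the set \<open>S\<close> below yield points of the
  epigraph, so \<open>w\<close> is a limit of points of \<open>S\<close>, where the claim follows
  from \<open>c \<in> C_beta X A \<beta>\<close> by monotonicity.\<close>

lemma inner_exp_nonneg_if_nonneg_epi_cone:
  fixes w :: "real^'k::finite"
  assumes X: "X \<noteq> {}" "convex X"
    and w: "\<And>p. p \<in> epi_cone X A \<beta> \<Longrightarrow> (w, 1) \<bullet> p \<ge> 0"
    and c: "c \<in> C_beta X A \<beta>"
  shows "(\<Sum>k\<in>UNIV. c $ k * exp (w $ k)) \<ge> 0"
proof -
  \<comment> \<open>Exponent vectors of points of \<open>X\<close>, shifted by constant vectors and
    raised in entries other than \<open>\<beta>\<close>.\<close>
  define S where "S = {z :: real^'k. \<exists>x\<in>X. \<forall>k. (A k - A \<beta>) \<bullet> x \<le> z $ k - z $ \<beta>}"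
  have "convex S"
    unfolding convex_alt
  proof clarify
    fix z z' and u :: real
    assume zs: "z \<in> S" "z' \<in> S" and u: "0 \<le> u" "u \<le> 1"
    obtain x x' where x: "x \<in> X" "\<And>k. (A k - A \<beta>) \<bullet> x \<le> z $ k - z $ \<beta>"
      and x': "x' \<in> X" "\<And>k. (A k - A \<beta>) \<bullet> x' \<le> z' $ k - z' $ \<beta>"
      using zs by (auto simp: S_def)
    have "(1 - u) *\<^sub>R x + u *\<^sub>R x' \<in> X"
      using X(2) x x' u by (simp add: convex_alt)
    moreover have "(A k - A \<beta>) \<bullet> ((1 - u) *\<^sub>R x + u *\<^sub>R x')
        \<le> ((1 - u) *\<^sub>R z + u *\<^sub>R z') $ k - ((1 - u) *\<^sub>R z + u *\<^sub>R z') $ \<beta>" for k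
    proof -
      have "(A k - A \<beta>) \<bullet> ((1 - u) *\<^sub>R x + u *\<^sub>R x')
          = (1 - u) * ((A k - A \<beta>) \<bullet> x) + u * ((A k - A \<beta>) \<bullet> x')"
        by (simp add: inner_add_right)
      also have "\<dots> \<le> (1 - u) * (z $ k - z $ \<beta>) + u * (z' $ k - z' $ \<beta>)"
        using x(2) x'(2) u by (intro add_mono mult_left_mono) auto
      finally show ?thesis by (simp add: algebra_simps)
    qed
    ultimately show "(1 - u) *\<^sub>R z + u *\<^sub>R z' \<in> S"
      unfolding S_def by blast
  qed
  have expS: "(\<chi> k. A k \<bullet> x) \<in> S" if "x \<in> X" for x
    using that by (auto simp: S_def inner_diff_left)
  have "w \<in> closure S"
  proof (rule ccontr)
    assume "w \<notin> closure S"
    then obtain a b where ab: "a \<bullet> w < b" "\<And>z. z \<in> closure S \<Longrightarrow> a \<bullet> z > b"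
      using separating_hyperplane_closed_point[of "closure S" w] \<open>convex S\<close>
      by (auto simp: convex_closure)
    obtain x0 where x0: "x0 \<in> X" using X by blast
    define z0 :: "real^'k" where "z0 = (\<chi> k. A k \<bullet> x0)"
    \<comment> \<open>\<open>a\<close> exceeds \<open>b\<close> on \<open>S\<close>, so it cannot
      decrease along a ray in \<open>S\<close>; \<open>t\<close> is where it would reach exactly
      \<open>b\<close>.\<close>
    have ray: "a \<bullet> d \<ge> 0" if d: "\<And>t. t \<ge> 0 \<Longrightarrow> z0 + t *\<^sub>R d \<in> S" for d
    proof (rule ccontr)
      assume "\<not> a \<bullet> d \<ge> 0"
      then have neg: "a \<bullet> d < 0" by simp
      define t where "t = (a \<bullet> z0 - b) / (- (a \<bullet> d))"
      have "a \<bullet> z0 > b" using ab(2) d[of 0] closure_subset by auto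
      then have "t \<ge> 0" using neg by (simp add: t_def divide_nonneg_neg)
      then have "a \<bullet> (z0 + t *\<^sub>R d) > b" using ab(2) d closure_subset by blast
      moreover have "a \<bullet> (z0 + t *\<^sub>R d) = b"
        using neg unfolding inner_add_right inner_scaleR_right t_def by (simp add: field_simps)
      ultimately show False by simp
    qed
    have "a $ k \<ge> 0" if "k \<noteq> \<beta>" for k
    proof -
      have "a \<bullet> axis k 1 \<ge> 0"
      proof (rule ray)
        fix t :: real assume "t \<ge> 0"
        then show "z0 + t *\<^sub>R axis k 1 \<in> S"
          using x0 that by (auto simp: S_def z0_def inner_diff_left axis_def intro!: bexI[of _ x0])
      qed
      then show ?thesis by (simp add: inner_axis)
    qed
    moreover have "(\<Sum>k\<in>UNIV. a $ k) = 0"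
    \<comment> \<open>Constant vectors of both signs are admissible directions, which forces
      equality.\<close>
    proof -
      have "a \<bullet> d \<ge> 0" if "d = (\<chi> k. r)" for d r
        by (rule ray) (use x0 that in \<open>auto simp: S_def z0_def inner_diff_left intro!: bexI[of _ x0]\<close>)
      from this[OF refl, of 1] this[OF refl, of "-1"] show ?thesis
        by (simp add: inner_vec_def sum_negf)
    qed
    ultimately have "a \<in> Nset \<beta>" by (simp add: Nset_def)
    moreover have "- (Amul A a \<bullet> x) \<le> - b" if "x \<in> X" for x
    proof -
      have "a \<bullet> (\<chi> k. A k \<bullet> x) > b"
        using ab(2) expS[OF that] closure_subset by blast
      moreover have "a \<bullet> (\<chi> k. A k \<bullet> x) = Amul A a \<bullet> x"
        unfolding inner_Amul by (simp add: inner_vec_def)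
      ultimately show ?thesis by simp
    qed
    ultimately have "(a, - b) \<in> epi_cone X A \<beta>" by (simp add: epi_cone_def)
    from w[OF this] show False using ab(1) by (simp add: inner_commute)
  qed
  moreover have "closure S \<subseteq> {z. (\<Sum>k\<in>UNIV. c $ k * exp (z $ k)) \<ge> 0}"
  proof (rule closure_minimal)
    show "closed {z::real^'k. (\<Sum>k\<in>UNIV. c $ k * exp (z $ k)) \<ge> 0}"
      by (intro closed_Collect_le continuous_intros)
    show "S \<subseteq> {z. (\<Sum>k\<in>UNIV. c $ k * exp (z $ k)) \<ge> 0}"
    proof clarify
      fix z assume "z \<in> S"
      then obtain x where x: "x \<in> X" "\<And>k. (A k - A \<beta>) \<bullet> x \<le> z $ k - z $ \<beta>"
        by (auto simp: S_def)
      \<comment> \<open>This factor makes the exponent at \<open>\<beta>\<close>, where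
        \<open>c\<close> may be negative, equal to \<open>z $ \<beta>\<close>; the other exponents
        are at most those of \<open>z\<close>.\<close>
      have "0 \<le> exp (z $ \<beta> - A \<beta> \<bullet> x) * signomial A c x"
        using c x(1) by (auto simp: C_beta_def)
      also have "\<dots> = (\<Sum>k\<in>UNIV. c $ k * exp ((A k - A \<beta>) \<bullet> x + z $ \<beta>))"
      proof -
        have "exp (z $ \<beta> - A \<beta> \<bullet> x) * exp (A k \<bullet> x) = exp ((A k - A \<beta>) \<bullet> x + z $ \<beta>)" for k
          by (simp add: mult_exp_exp inner_diff_left)
        then show ?thesis by (simp add: signomial_def sum_distrib_left mult.left_commute)
      qed
      also have "\<dots> \<le> (\<Sum>k\<in>UNIV. c $ k * exp (z $ k))"
      proof (rule sum_mono)
        fix k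
        show "c $ k * exp ((A k - A \<beta>) \<bullet> x + z $ \<beta>) \<le> c $ k * exp (z $ k)"
        proof (cases "k = \<beta>")
          case False
          then have "c $ k \<ge> 0" using c by (simp add: C_beta_def)
          moreover have "(A k - A \<beta>) \<bullet> x + z $ \<beta> \<le> z $ k" using x(2)[of k] by linarith
          ultimately show ?thesis by (intro mult_left_mono) auto
        qed simp
      qed
      finally show "(\<Sum>k\<in>UNIV. c $ k * exp (z $ k)) \<ge> 0" .
    qed
  qed
  ultimately show ?thesis by blast
qed

text \<open>A vector \<open>v\<close> in the dual of the reduced cones is moved into the positive orthant, so that
  \<open>(ln v, 1)\<close> makes sense; it is then nonnegative on the extreme rays of the circuit graph.\<close>

lemma dual_of_reduced_circuit_cones:
  fixes A :: "'k::finite \<Rightarrow> real^'n"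
  assumes X: "X \<noteq> {}" "convex X"
    and indep: "\<forall>c::real^'k. (\<forall>x\<in>X. (\<Sum>k\<in>UNIV. c $ k * exp (A k \<bullet> x)) = 0) \<longrightarrow> c = 0"
    and v: "\<And>k. v $ k \<ge> 0"
    and dual: "\<And>lam c. lam \<in> Lambda_X_star X A \<Longrightarrow> c \<in> C_lambda X A lam \<Longrightarrow> v \<bullet> c \<ge> 0"
    and c: "c \<in> C_beta X A \<beta>"
  shows "v \<bullet> c \<ge> 0"
proof -
  obtain u :: "real^'k" where u: "\<And>k. u $ k > 0"
    and pos: "\<And>c. c \<noteq> 0 \<Longrightarrow> (\<And>x. x \<in> X \<Longrightarrow> signomial A c x \<ge> 0) \<Longrightarrow> u \<bullet> c > 0"
    using strictly_positive_functional_exists[OF indep] by blast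
  have u_nonneg: "u \<bullet> d \<ge> 0" if "d \<in> (\<Union>\<beta>. C_beta X A \<beta>)" for d
    using that pos[of d] by (cases "d = 0") (auto simp: C_beta_def intro: less_imp_le)
  \<comment> \<open>Adding \<open>e *\<^sub>R u\<close> makes every entry positive and keeps
    nonnegativity on the witnessed cones; finally \<open>e\<close> tends to 0.\<close>
  have eps: "v \<bullet> c + e * (u \<bullet> c) \<ge> 0" if e: "e > 0" for e
  proof -
    define v' where "v' = v + e *\<^sub>R u"
    define w where "w = (\<chi> k. ln (v' $ k))"
    have v': "v' $ k > 0" for k using v[of k] u[of k] e by (simp add: v'_def add_nonneg_pos)
    have "epi_cone X A \<beta> \<subseteq> {p. (w, 1) \<bullet> p \<ge> 0}"
    proof (rule epi_cone_subset_if_reduced_circuits[OF X(1) epi_cone_pos[OF X(1) u pos]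
          convex_cone_halfspace_ge])
      fix lam assume star: "lam \<in> Lambda_X_star X A"
      then have Lam: "lam \<in> Lambda_X X A" by (simp add: Lambda_X_star_def)
      then obtain \<gamma> where g: "lam \<in> Nset \<gamma>" "lam $ \<gamma> = -1" by (rule Lambda_XE)
      let ?d = "age_witness \<gamma> lam (real_of_ereal (supp_fn X (- Amul A lam))) v'"
      have d: "?d \<in> C_lambda X A lam" by (rule age_witness_in_C_lambda[OF g v'])
      then have "v \<bullet> ?d \<ge> 0" "u \<bullet> ?d \<ge> 0"
        using dual[OF star] u_nonneg C_lambda_subset_C_beta[OF X(1) Lam] by blast+
      then have "v' \<bullet> ?d \<ge> 0" using e by (simp add: v'_def inner_add_left)
      then show "phi X A lam \<in> {p. (w, 1) \<bullet> p \<ge> 0}"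
        unfolding inner_age_witness[OF g v'] phi_def w_def by simp
    qed auto
    then have "(\<Sum>k\<in>UNIV. c $ k * exp (w $ k)) \<ge> 0"
      using X c by (intro inner_exp_nonneg_if_nonneg_epi_cone) auto
    also have "(\<Sum>k\<in>UNIV. c $ k * exp (w $ k)) = v' \<bullet> c"
      using v' by (simp add: w_def inner_vec_def mult.commute)
    finally show ?thesis by (simp add: v'_def inner_add_left)
  qed
  have "((\<lambda>e. v \<bullet> c + e * (u \<bullet> c)) \<longlongrightarrow> v \<bullet> c + 0 * (u \<bullet> c)) (at_right 0)"
    by (intro tendsto_intros)
  moreover have "\<forall>\<^sub>F e in at_right 0. v \<bullet> c + e * (u \<bullet> c) \<ge> 0"
    using eps by (auto simp: eventually_at_right_less intro: eventually_mono[OF eventually_at_right_less])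
  ultimately show ?thesis
    using tendsto_lowerbound[of "\<lambda>e. v \<bullet> c + e * (u \<bullet> c)" "v \<bullet> c + 0 * (u \<bullet> c)"
        "at_right 0" 0] by simp
qed

section \<open>Convexity and closedness of the SAGE cone\<close>

lemma convex_cone_C_beta: "convex_cone (C_beta X A \<beta>)"
  unfolding convex_cone_iff C_beta_def
  by (auto simp: signomial_inner inner_add_right)

lemma closed_C_beta: "closed (C_beta X A \<beta>)"
proof -
  have "C_beta X A \<beta> = {c. (\<forall>k. k \<noteq> \<beta> \<longrightarrow> 0 \<le> c $ k) \<and>
      (\<forall>x. x \<in> X \<longrightarrow> 0 \<le> (\<Sum>k\<in>UNIV. c $ k * exp (A k \<bullet> x)))}"
    by (auto simp: C_beta_def signomial_def)
  also have "closed \<dots>"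
    by (intro closed_Collect_conj closed_Collect_all closed_Collect_imp
        closed_Collect_le continuous_intros open_Collect_const)
  finally show ?thesis .
qed

lemma convex_cone_SAGE_cone: "convex_cone (SAGE_cone X A)"
  unfolding convex_cone_iff
proof (intro conjI ballI allI impI)
  have "0 \<in> C_beta X A \<beta>" for \<beta> using convex_cone_C_beta by (rule convex_cone_contains_0)
  then show "0 \<in> SAGE_cone X A"
    unfolding SAGE_cone_def by (auto intro!: exI[of _ "\<lambda>_. 0"])
next
  fix c d assume "c \<in> SAGE_cone X A" "d \<in> SAGE_cone X A"
  then obtain g h where "\<And>\<beta>. g \<beta> \<in> C_beta X A \<beta>" "c = (\<Sum>\<beta>\<in>UNIV. g \<beta>)"
    "\<And>\<beta>. h \<beta> \<in> C_beta X A \<beta>" "d = (\<Sum>\<beta>\<in>UNIV. h \<beta>)"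
    unfolding SAGE_cone_def by blast
  then show "c + d \<in> SAGE_cone X A"
    unfolding SAGE_cone_def
    by (auto simp: sum.distrib intro!: exI[of _ "\<lambda>\<beta>. g \<beta> + h \<beta>"] convex_cone_add[OF convex_cone_C_beta])
next
  fix c and r :: real assume "c \<in> SAGE_cone X A" "r \<ge> 0"
  then obtain g where "\<And>\<beta>. g \<beta> \<in> C_beta X A \<beta>" "c = (\<Sum>\<beta>\<in>UNIV. g \<beta>)"
    unfolding SAGE_cone_def by blast
  then show "r *\<^sub>R c \<in> SAGE_cone X A"
    unfolding SAGE_cone_def using \<open>r \<ge> 0\<close>
    by (auto simp: scaleR_sum_right intro!: exI[of _ "\<lambda>\<beta>. r *\<^sub>R g \<beta>"]
        convex_cone_scaleR[OF convex_cone_C_beta])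
qed

lemma C_beta_subset_SAGE_cone: "C_beta X A \<beta> \<subseteq> SAGE_cone X A"
proof
  fix c assume "c \<in> C_beta X A \<beta>"
  then have "\<forall>\<gamma>. (if \<gamma> = \<beta> then c else 0) \<in> C_beta X A \<gamma>"
    using convex_cone_contains_0[OF convex_cone_C_beta] by auto
  moreover have "c = (\<Sum>\<gamma>\<in>UNIV. if \<gamma> = \<beta> then c else 0)" by simp
  ultimately show "c \<in> SAGE_cone X A"
    unfolding SAGE_cone_def mem_Collect_eq by (intro exI[of _ "\<lambda>\<gamma>. if \<gamma> = \<beta> then c else 0"]) blast
qed

text \<open>Sums of closed cones can fail to be closed. Here a strictly positive functional exhibits
  the sum as the conic hull of a compact convex base that misses 0.\<close>

lemma closed_SAGE_cone:
  fixes A :: "'k::finite \<Rightarrow> real^'n"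
  assumes indep: "\<forall>c::real^'k. (\<forall>x\<in>X. (\<Sum>k\<in>UNIV. c $ k * exp (A k \<bullet> x)) = 0) \<longrightarrow> c = 0"
  shows "closed (SAGE_cone X A)"
proof -
  obtain u :: "real^'k" where u: "\<And>k. u $ k > 0"
    and u_pos: "\<And>c. c \<noteq> 0 \<Longrightarrow> (\<And>x. x \<in> X \<Longrightarrow> signomial A c x \<ge> 0) \<Longrightarrow> u \<bullet> c > 0"
    using strictly_positive_functional_exists[OF indep] by blast
  let ?E = "\<Union>\<beta>. C_beta X A \<beta>"
  let ?B = "convex hull (?E \<inter> {y. u \<bullet> y = 1})"
  have pos: "0 < u \<bullet> y" if "y \<in> ?E" "y \<noteq> 0" for y
    using that u_pos by (auto simp: C_beta_def)
  have cl: "closed ?E" by (intro closed_UN) (auto intro: closed_C_beta)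
  have con: "conic ?E" using convex_cone_C_beta unfolding convex_cone_def conic_def by blast
  \<comment> \<open>Rescaling this vector shows that the base is nonempty, which puts 0 into its
    conic hull.\<close>
  have "(\<chi> k. 1) \<in> ?E" using nonneg_in_C_beta[of "\<chi> k. 1"] by auto
  then have "(1 / (u \<bullet> (\<chi> k. 1))) *\<^sub>R (\<chi> k. 1) \<in> ?E \<inter> {y. u \<bullet> y = 1}"
    using pos[of "\<chi> k. 1"] conicD[OF con, of "\<chi> k. 1"] by (auto simp: vec_eq_iff less_imp_le)
  then have ne: "?B \<noteq> {}" using hull_inc by fastforce
  have 0: "0 \<in> conic hull ?B" using ne by (simp add: conic_contains_0 conic_conic_hull conic_hull_eq_empty)
  have "0 \<notin> ?B" using inner_convex_hull_base[of 0 ?E u] by auto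
  moreover have "compact ?B"
    by (intro compact_convex_hull compact_cone_base cl con pos)
  ultimately have "closed (conic hull ?B)" by (intro closed_conic_hull) auto
  moreover have "conic hull ?B = SAGE_cone X A"
  proof
    have "?E \<subseteq> SAGE_cone X A" using C_beta_subset_SAGE_cone by blast
    then have "?B \<subseteq> SAGE_cone X A"
      using convex_cone_SAGE_cone[of X A] by (intro hull_minimal) (auto simp: convex_cone_def)
    then show "conic hull ?B \<subseteq> SAGE_cone X A"
      using convex_cone_SAGE_cone[of X A] by (intro hull_minimal[of ?B]) (simp_all add: convex_cone_def)
    have cc: "convex_cone (conic hull ?B)"
      using 0 convex_conic_hull[OF convex_convex_hull] conic_conic_hull
      unfolding convex_cone_def by blast
    have "?E \<subseteq> conic hull ?B"
      by (rule conic_subset_if_base_subset[OF con pos conic_conic_hull 0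
            order_trans[OF hull_subset hull_subset]])
    then have mem: "g \<beta> \<in> conic hull ?B" if "\<And>\<beta>. g \<beta> \<in> C_beta X A \<beta>" for g \<beta>
      using that by blast
    have "(\<Sum>\<beta>\<in>F. g \<beta>) \<in> conic hull ?B" if "\<And>\<beta>. g \<beta> \<in> C_beta X A \<beta>" "finite F" for g F
      using that(2)
    proof induction
      case empty
      show ?case using 0 by (simp only: sum.empty)
    next
      case (insert \<beta> F)
      then show ?case
        using convex_cone_add[OF cc mem[OF that(1)] insert.IH] by simp
    qed
    then show "SAGE_cone X A \<subseteq> conic hull ?B"
      unfolding SAGE_cone_def by auto
  qed
  ultimately show ?thesis by simp
qed

section \<open>Witnessed cones and the separation argument\<close>

text \<open>The weighted product is homogeneous of degree 1 because the positive entries of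
  \<open>lam\<close> sum to 1.\<close>

lemma C_lambda_scaleR:
  assumes lam: "lam \<in> Lambda_X X A" and c: "c \<in> C_lambda X A lam" and t: "t \<ge> 0"
  shows "t *\<^sub>R c \<in> C_lambda X A lam"
proof -
  let ?s = "real_of_ereal (supp_fn X (- Amul A lam))"
  let ?P = "{k. lam $ k > 0}"
  obtain \<gamma> where g: "lam \<in> Nset \<gamma>" "lam $ \<gamma> = -1" using lam by (rule Lambda_XE)
  obtain \<beta> where b: "lam $ \<beta> < 0" "\<And>k. k \<noteq> \<beta> \<Longrightarrow> c $ k \<ge> 0"
    "(\<Prod>k\<in>?P. (c $ k / lam $ k) powr (lam $ k)) \<ge> - c $ \<beta> * exp ?s"
    using c by (auto simp: C_lambda_def)
  have "t * (\<Prod>k\<in>?P. (c $ k / lam $ k) powr (lam $ k)) \<ge> t * (- c $ \<beta> * exp ?s)"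
    using b(3) t by (rule mult_left_mono)
  moreover have "(\<Prod>k\<in>?P. ((t *\<^sub>R c) $ k / lam $ k) powr (lam $ k)) =
      t * (\<Prod>k\<in>?P. (c $ k / lam $ k) powr (lam $ k))"
  proof -
    have "(\<Prod>k\<in>?P. ((t *\<^sub>R c) $ k / lam $ k) powr (lam $ k)) =
        (\<Prod>k\<in>?P. t powr (lam $ k) * (c $ k / lam $ k) powr (lam $ k))"
    proof (rule prod.cong)
      fix k assume "k \<in> ?P"
      then have "c $ k / lam $ k \<ge> 0" using b(1,2) by (metis divide_nonneg_pos mem_Collect_eq order_less_asym)
      then show "((t *\<^sub>R c) $ k / lam $ k) powr (lam $ k) =
          t powr (lam $ k) * (c $ k / lam $ k) powr (lam $ k)"
        using powr_mult[of t "c $ k / lam $ k" "lam $ k"] t by simp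
    qed simp
    also have "\<dots> = (\<Prod>k\<in>?P. t powr (lam $ k)) * (\<Prod>k\<in>?P. (c $ k / lam $ k) powr (lam $ k))"
      by (rule prod.distrib)
    also have "(\<Prod>k\<in>?P. t powr (lam $ k)) = t"
    proof (cases "t = 0")
      case True
      have "?P \<noteq> {}" using Nset_sum_pos[OF g] by (metis sum.empty zero_neq_one)
      then show ?thesis using True by (simp add: card_gt_0_iff)
    next
      case False
      then show ?thesis
        using t Nset_sum_pos[OF g] by (simp add: powr_sum[symmetric])
    qed
    finally show ?thesis .
  qed
  ultimately show ?thesis
    unfolding C_lambda_def using b(1,2) t by (auto intro!: exI[of _ \<beta>] simp: mult.assoc)
qed

lemma nonneg_in_C_lambda:
  assumes "lam \<in> Lambda_X X A" and c: "\<And>k. c $ k \<ge> 0"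
  shows "c \<in> C_lambda X A lam"
proof -
  obtain \<gamma> where g: "lam $ \<gamma> = -1" using assms(1) by (rule Lambda_XE)
  have "- c $ \<gamma> * exp (real_of_ereal (supp_fn X (- Amul A lam))) \<le> 0"
    using c[of \<gamma>] by simp
  also have "0 \<le> (\<Prod>k\<in>{k. lam $ k > 0}. (c $ k / lam $ k) powr (lam $ k))"
    by (intro prod_nonneg) auto
  finally show ?thesis
    unfolding C_lambda_def using c g by (auto intro!: exI[of _ \<gamma>])
qed

text \<open>A hyperplane separating a point from \<open>K\<close> has its normal in the dual of the
  orthant and of the reduced cones, hence nonnegative on every AGE summand. \<open>K\<close> stands
  for the orthant or for the closed hull.\<close>

lemma SAGE_cone_subset:
  fixes A :: "'k::finite \<Rightarrow> real^'n"
  assumes X: "X \<noteq> {}" "convex X"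
    and indep: "\<forall>c::real^'k. (\<forall>x\<in>X. (\<Sum>k\<in>UNIV. c $ k * exp (A k \<bullet> x)) = 0) \<longrightarrow> c = 0"
    and K: "closed K" "convex K" "nonneg_orthant \<subseteq> K"
    and star: "\<And>lam. lam \<in> Lambda_X_star X A \<Longrightarrow> C_lambda X A lam \<subseteq> K"
  shows "SAGE_cone X A \<subseteq> K"
proof
  fix c assume "c \<in> SAGE_cone X A"
  then obtain g where g: "\<And>\<beta>. g \<beta> \<in> C_beta X A \<beta>" "c = (\<Sum>\<beta>\<in>UNIV. g \<beta>)"
    unfolding SAGE_cone_def by blast
  show "c \<in> K"
  proof (rule ccontr)
    assume "c \<notin> K"
    then obtain v b where vb: "v \<bullet> c < b" "\<And>y. y \<in> K \<Longrightarrow> v \<bullet> y > b"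
      using separating_hyperplane_closed_point[OF K(2,1)] by blast
    have "0 \<in> K" using K(3) by (auto simp: nonneg_orthant_def)
    then have "b < 0" using vb(2)[of 0] by simp
    \<comment> \<open>If \<open>v \<bullet> d\<close> were negative, the multiple
      \<open>b / (v \<bullet> d)\<close> of \<open>d\<close> would have value exactly
      \<open>b\<close>, which is excluded on \<open>K\<close>.\<close>
    have ray: "v \<bullet> d \<ge> 0" if d: "\<And>t. t \<ge> 0 \<Longrightarrow> t *\<^sub>R d \<in> K" for d
    proof (rule ccontr)
      assume "\<not> v \<bullet> d \<ge> 0"
      then have "v \<bullet> ((b / (v \<bullet> d)) *\<^sub>R d) > b"
        using \<open>b < 0\<close> by (intro vb(2) d) (simp add: divide_nonpos_neg)
      then show False using \<open>\<not> v \<bullet> d \<ge> 0\<close> by simp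
    qed
    have "v $ k \<ge> 0" for k
    proof -
      have "v \<bullet> axis k 1 \<ge> 0"
        by (rule ray) (use K(3) in \<open>auto simp: nonneg_orthant_def axis_def\<close>)
      then show ?thesis by (simp add: inner_axis)
    qed
    moreover have "v \<bullet> d \<ge> 0" if "lam \<in> Lambda_X_star X A" "d \<in> C_lambda X A lam" for lam d
      using that by (intro ray subsetD[OF star] C_lambda_scaleR) (auto simp: Lambda_X_star_def)
    ultimately have "v \<bullet> g \<beta> \<ge> 0" for \<beta>
      using dual_of_reduced_circuit_cones[OF X indep] g(1) by blast
    then have "v \<bullet> c \<ge> 0" unfolding g(2) inner_sum_right by (intro sum_nonneg) auto
    then show False using vb(1) \<open>b < 0\<close> by simp
  qed
qed

lemma nonneg_orthant_subset_SAGE_cone: "nonneg_orthant \<subseteq> SAGE_cone X A"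
  using nonneg_in_C_beta C_beta_subset_SAGE_cone by (fastforce simp: nonneg_orthant_def)

theorem theorem5p5:
  fixes X :: "(real^'n) set" and A :: "'k::finite \<Rightarrow> real^'n"
  assumes "closed X" and "convex X" and "X \<noteq> {}"
    and "inj A"
    and "\<forall>c::real^'k. (\<forall>x\<in>X. (\<Sum>k\<in>UNIV. c $ k * exp (A k \<bullet> x)) = 0) \<longrightarrow> c = 0"
  shows "(Lambda_X X A = {} \<longrightarrow> SAGE_cone X A = nonneg_orthant) \<and>
         (Lambda_X X A \<noteq> {} \<longrightarrow>
            SAGE_cone X A = closure (convex hull (\<Union>lam\<in>Lambda_X_star X A. C_lambda X A lam)))"
proof (intro conjI impI)
  assume empty: "Lambda_X X A = {}"
  have "closed (nonneg_orthant :: (real^'k) set)"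
    unfolding nonneg_orthant_def by (intro closed_Collect_all closed_Collect_le continuous_intros)
  moreover have "convex (nonneg_orthant :: (real^'k) set)"
    by (auto simp: nonneg_orthant_def convex_def)
  ultimately have "SAGE_cone X A \<subseteq> nonneg_orthant"
    using assms empty by (intro SAGE_cone_subset) (auto simp: Lambda_X_star_def)
  then show "SAGE_cone X A = nonneg_orthant"
    using nonneg_orthant_subset_SAGE_cone by blast
next
  assume nonempty: "Lambda_X X A \<noteq> {}"
  let ?U = "\<Union>lam\<in>Lambda_X_star X A. C_lambda X A lam"
  have U: "?U \<subseteq> closure (convex hull ?U)"
    by (rule order_trans[OF hull_subset closure_subset])
  obtain u :: "real^'k" where u: "\<And>k. u $ k > 0"
    and pos: "\<And>c. c \<noteq> 0 \<Longrightarrow> (\<And>x. x \<in> X \<Longrightarrow> signomial A c x \<ge> 0) \<Longrightarrow> u \<bullet> c > 0"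
    using strictly_positive_functional_exists[OF assms(5)] by blast
  \<comment> \<open>One reduced circuit suffices to place the orthant inside the union.\<close>
  have "Lambda_X_star X A \<noteq> {}"
    using epi_cone_pos[OF assms(3) u pos] by (rule Lambda_X_star_nonempty[OF assms(3) _ nonempty])
  then obtain lam where lam: "lam \<in> Lambda_X_star X A" by blast
  then have "nonneg_orthant \<subseteq> C_lambda X A lam"
    by (auto simp: nonneg_orthant_def Lambda_X_star_def intro: nonneg_in_C_lambda)
  then have "nonneg_orthant \<subseteq> closure (convex hull ?U)"
    using lam U by blast
  then have "SAGE_cone X A \<subseteq> closure (convex hull ?U)"
    using assms U by (intro SAGE_cone_subset) (auto intro: convex_closure)
  moreover have "closure (convex hull ?U) \<subseteq> SAGE_cone X A"
  proof (intro closure_minimal hull_minimal closed_SAGE_cone assms)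
    show "?U \<subseteq> SAGE_cone X A"
      using C_lambda_subset_C_beta[OF assms(3)] C_beta_subset_SAGE_cone
      by (fastforce simp: Lambda_X_star_def)
    show "convex (SAGE_cone X A)"
      using convex_cone_SAGE_cone by (auto simp: convex_cone_def)
  qed
  ultimately show "SAGE_cone X A = closure (convex hull ?U)"
    by blast
qed

end
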